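(* Let $M\in\mathcal{M}$. The mean $M$ is Schur-convex (resp. Schur-concave) if and only if the function $z\mapsto f_M(z)/z$ decreases (resp. increases) on $(0,1)$.
   Context: $\mathbb{R}_+=(0,\infty)$. $\mathcal{M}$ is the set of functions $M:\mathbb{R}_+^2\to\mathbb{R}$ (called means) that are symmetric, positively homogeneous of order $1$ ($M(\lambda x,\lambda y)=\lambda M(x,y)$ for $\lambda>0$), and satisfy $\min(x,y)\leqslant M(x,y)\leqslant\max(x,y)$. For $M\in\mathcal{M}$ put $f_M(z)=\frac{z}{M(1+z,1-z)}$, $z\in(0,1)$. On $\mathbb{R}_+^2$ write $(x_1,y_1)\prec(x_2,y_2)$ if $x_1+y_1=x_2+y_2$ and $\max(x_1,y_1)\leqslant\max(x_2,y_2)$. A symmetric function $h:\mathbb{R}_+^2\to\mathbb{R}$ is Schur-convex if $(x_1,y_1)\prec(x_2,y_2)$ implies $h(x_1,y_1)\leqslant h(x_2,y_2)$, and Schur-concave if $(x_1,y_1)\prec(x_2,y_2)$ implies $h(x_1,y_1)\geqslant h(x_2,y_2)$. "Increases" and "decreases" are meant in the non-strict sense. *)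

theory Defs
  imports Complex_Main
begin

text \<open>
  A function on the open positive quadrant is represented by a curried total function on the reals;
  every condition below is restricted to positive arguments, so that values elsewhere are
  irrelevant.
\<close>

definition symmetric_pos :: "(real \<Rightarrow> real \<Rightarrow> real) \<Rightarrow> bool" where
  "symmetric_pos h \<longleftrightarrow> (\<forall>x>0. \<forall>y>0. h x y = h y x)"

definition means :: "(real \<Rightarrow> real \<Rightarrow> real) set" where
  "means = {M. symmetric_pos M
     \<and> (\<forall>c>0. \<forall>x>0. \<forall>y>0. M (c * x) (c * y) = c * M x y)
     \<and> (\<forall>x>0. \<forall>y>0. min x y \<le> M x y \<and> M x y \<le> max x y)}"

text \<open>Only the values on the open interval from 0 to 1 are meaningful.\<close>

definition seiffert :: "(real \<Rightarrow> real \<Rightarrow> real) \<Rightarrow> real \<Rightarrow> real" where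
  "seiffert M z = z / M (1 + z) (1 - z)"

definition majorized :: "real \<times> real \<Rightarrow> real \<times> real \<Rightarrow> bool" where
  "majorized = (\<lambda>(x1, y1) (x2, y2). x1 + y1 = x2 + y2 \<and> max x1 y1 \<le> max x2 y2)"

definition schur_convex :: "(real \<Rightarrow> real \<Rightarrow> real) \<Rightarrow> bool" where
  "schur_convex h \<longleftrightarrow> symmetric_pos h
     \<and> (\<forall>x1>0. \<forall>y1>0. \<forall>x2>0. \<forall>y2>0. majorized (x1, y1) (x2, y2) \<longrightarrow> h x1 y1 \<le> h x2 y2)"

definition schur_concave :: "(real \<Rightarrow> real \<Rightarrow> real) \<Rightarrow> bool" where
  "schur_concave h \<longleftrightarrow> symmetric_pos h
     \<and> (\<forall>x1>0. \<forall>y1>0. \<forall>x2>0. \<forall>y2>0. majorized (x1, y1) (x2, y2) \<longrightarrow> h x1 y1 \<ge> h x2 y2)"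

end

theory Submission
  imports Defs
begin

text \<open>
  A symmetric homogeneous function \<open>h\<close> is determined by its trace
  \<open>g z = h (1 + z) (1 - z)\<close> on the segment \<open>x + y = 2\<close>: with \<open>s = x + y\<close> one has
  \<open>h x y = (s / 2) * g (\<bar>x - y\<bar> / s)\<close>. For a fixed sum \<open>s\<close>, majorization merely compares
  \<open>\<bar>x - y\<bar>\<close>, so \<open>h\<close> is Schur-convex precisely when \<open>g\<close> increases on \<open>[0, 1)\<close>
  (\<open>schur_convex_iff_trace_mono\<close>). Passing to \<open>- h\<close> gives the Schur-concave case.

  For a mean \<open>M\<close>, \<open>seiffert M z / z\<close> equals \<open>1 / g z\<close> with \<open>g\<close> positive,
  so monotonicity is reversed. The one discrepancy is the point \<open>z = 0\<close>, that is, the diagonal,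
  which the open interval \<open>(0, 1)\<close> omits. It can be added because \<open>1 - z \<le> g z \<le> 1 + z\<close> makes
  \<open>g\<close> right-continuous at \<open>0\<close>, and monotonicity then extends to \<open>0\<close>
  (\<open>mono_on_trace_include_zero\<close>).
\<close>

definition homogeneous_pos :: "(real \<Rightarrow> real \<Rightarrow> real) \<Rightarrow> bool" where
  "homogeneous_pos h \<longleftrightarrow> (\<forall>c>0. \<forall>x>0. \<forall>y>0. h (c * x) (c * y) = c * h x y)"

definition trace :: "(real \<Rightarrow> real \<Rightarrow> real) \<Rightarrow> real \<Rightarrow> real" where
  "trace h z = h (1 + z) (1 - z)"

lemma eq_trace:
  assumes sym: "symmetric_pos h" and hom: "homogeneous_pos h" and pos: "x > 0" "y > 0"
  shows "h x y = (x + y) / 2 * trace h (\<bar>x - y\<bar> / (x + y))"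
proof -
  have ordered: "h a b = (a + b) / 2 * trace h ((a - b) / (a + b))" if "a > 0" "b > 0" for a b
  proof -
    define c where "c = (a + b) / 2"
    have c: "c > 0" using that by (simp add: c_def)
    have a: "1 + (a - b) / (a + b) = a / c" and b: "1 - (a - b) / (a + b) = b / c"
      using that by (simp_all add: c_def field_simps)
    have "c * h (a / c) (b / c) = h (c * (a / c)) (c * (b / c))"
      using hom c that by (simp add: homogeneous_pos_def del: nonzero_mult_div_cancel_left times_divide_eq_right)
    then show ?thesis
      using c unfolding trace_def a b by (simp add: c_def[symmetric])
  qed
  show ?thesis
  proof (cases "y \<le> x")
    case True
    then show ?thesis using ordered[OF pos] by simp
  next
    case False
    have "h x y = h y x" using sym pos by (simp add: symmetric_pos_def)
    then show ?thesis using False ordered[OF pos(2,1)] by (simp add: add.commute)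
  qed
qed

text \<open>
  Since \<open>max x y = (x + y + \<bar>x - y\<bar>) / 2\<close>, two pairs with the same sum are ordered by
  majorization exactly as their normalized differences \<open>\<bar>x - y\<bar> / (x + y)\<close> are ordered.
\<close>
lemma schur_convex_iff_trace_mono:
  assumes sym: "symmetric_pos h" and hom: "homogeneous_pos h"
  shows "schur_convex h \<longleftrightarrow> mono_on {0..<1} (trace h)"
proof
  assume "schur_convex h"
  then show "mono_on {0..<1} (trace h)"
    by (intro mono_onI) (auto simp: schur_convex_def majorized_def trace_def)
next
  assume mono: "mono_on {0..<1} (trace h)"
  have "h x1 y1 \<le> h x2 y2"
    if pos: "x1 > 0" "y1 > 0" "x2 > 0" "y2 > 0" and maj: "majorized (x1, y1) (x2, y2)"
    for x1 y1 x2 y2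
  proof -
    have sum_eq: "x1 + y1 = x2 + y2" and "\<bar>x1 - y1\<bar> \<le> \<bar>x2 - y2\<bar>"
      using maj by (auto simp: majorized_def max_def abs_if split: if_splits)
    then have "\<bar>x1 - y1\<bar> / (x1 + y1) \<le> \<bar>x2 - y2\<bar> / (x2 + y2)"
      using pos by (simp add: divide_right_mono)
    moreover have "\<bar>x1 - y1\<bar> / (x1 + y1) \<in> {0..<1}" "\<bar>x2 - y2\<bar> / (x2 + y2) \<in> {0..<1}"
      using pos by auto
    ultimately have "trace h (\<bar>x1 - y1\<bar> / (x1 + y1)) \<le> trace h (\<bar>x2 - y2\<bar> / (x2 + y2))"
      using mono_onD[OF mono] by blast
    then show ?thesis
      unfolding eq_trace[OF sym hom pos(1,2)] eq_trace[OF sym hom pos(3,4)] sum_eq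
      using pos by (intro mult_left_mono) auto
  qed
  then show "schur_convex h" using sym by (simp add: schur_convex_def)
qed

lemma schur_concave_iff_uminus: "schur_concave h \<longleftrightarrow> schur_convex (\<lambda>x y. - h x y)"
  by (simp add: schur_concave_def schur_convex_def symmetric_pos_def)

text \<open>
  If \<open>0 < w < z\<close>, then \<open>g w \<le> g z\<close>; letting \<open>w\<close> tend to \<open>0\<close> gives \<open>g 0 \<le> g z\<close>.
\<close>
lemma mono_on_include_left_endpoint:
  fixes g :: "real \<Rightarrow> real"
  assumes mono: "mono_on {0<..<1} g" and lim: "(g \<longlongrightarrow> g 0) (at_right 0)"
  shows "mono_on {0..<1} g"
proof (rule mono_onI)
  fix w z :: real
  assume w: "w \<in> {0..<1}" and z: "z \<in> {0..<1}" and "w \<le> z"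
  show "g w \<le> g z"
  proof (cases "w = 0 \<and> z \<noteq> 0")
    case True
    then have "z > 0" using z by auto
    then have "\<forall>\<^sub>F v in at_right 0. v \<in> {0<..<z}" by (rule eventually_at_right_real)
    then have "\<forall>\<^sub>F v in at_right 0. g v \<le> g z"
      using z by (elim eventually_mono) (auto intro!: mono_onD[OF mono])
    then have "g 0 \<le> g z" by (intro tendsto_upperbound[OF lim]) auto
    then show ?thesis using True by simp
  next
    case False
    then show ?thesis using w z \<open>w \<le> z\<close> by (cases "w = z") (auto intro!: mono_onD[OF mono])
  qed
qed

lemma mean_trace_bounds:
  assumes "M \<in> means" and "0 \<le> z" and "z < 1"
  shows "1 - z \<le> trace M z" and "trace M z \<le> 1 + z"
proof -
  have "min (1 + z) (1 - z) \<le> trace M z \<and> trace M z \<le> max (1 + z) (1 - z)"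
  proof -
    have "\<forall>x>0. \<forall>y>0. min x y \<le> M x y \<and> M x y \<le> max x y"
      using assms(1) unfolding means_def by blast
    moreover have "1 + z > 0" "1 - z > 0" using assms by auto
    ultimately show ?thesis unfolding trace_def by blast
  qed
  then show "1 - z \<le> trace M z" and "trace M z \<le> 1 + z"
    using assms by auto
qed

lemma mean_trace_tendsto:
  assumes M: "M \<in> means"
  shows "(trace M \<longlongrightarrow> trace M 0) (at_right 0)"
proof -
  have near: "\<forall>\<^sub>F z in at_right 0. z \<in> {0<..<1::real}"
    by (rule eventually_at_right_real) simp
  have "(trace M \<longlongrightarrow> 1) (at_right 0)"
  proof (rule tendsto_sandwich)
    show "\<forall>\<^sub>F z in at_right 0. 1 - z \<le> trace M z"
      using near by eventually_elim (use mean_trace_bounds[OF M] in auto)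
    show "\<forall>\<^sub>F z in at_right 0. trace M z \<le> 1 + z"
      using near by eventually_elim (use mean_trace_bounds[OF M] in auto)
    show "((\<lambda>z. 1 - z) \<longlongrightarrow> 1) (at_right (0::real))" "((\<lambda>z. 1 + z) \<longlongrightarrow> 1) (at_right (0::real))"
      by (auto intro!: tendsto_eq_intros)
  qed
  moreover have "trace M 0 = 1" using mean_trace_bounds[OF M, of 0] by simp
  ultimately show ?thesis by simp
qed

lemma mono_on_trace_include_zero:
  assumes M: "M \<in> means"
  shows "mono_on {0..<1} (trace M) \<longleftrightarrow> mono_on {0<..<1} (trace M)"
    and "mono_on {0..<1} (\<lambda>z. - trace M z) \<longleftrightarrow> mono_on {0<..<1} (\<lambda>z. - trace M z)"
proof -
  have sub: "{0<..<1} \<subseteq> {0..<1::real}" by auto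
  note lim = mean_trace_tendsto[OF M]
  show "mono_on {0..<1} (trace M) \<longleftrightarrow> mono_on {0<..<1} (trace M)"
    using mono_on_include_left_endpoint[OF _ lim] mono_on_subset[OF _ sub] by blast
  show "mono_on {0..<1} (\<lambda>z. - trace M z) \<longleftrightarrow> mono_on {0<..<1} (\<lambda>z. - trace M z)"
    using mono_on_include_left_endpoint[OF _ tendsto_minus[OF lim]] mono_on_subset[OF _ sub]
    by blast
qed

theorem theorem6p1:
  fixes M :: "real \<Rightarrow> real \<Rightarrow> real"
  assumes "M \<in> means"
  shows "(schur_convex M \<longleftrightarrow> antimono_on {0<..<1} (\<lambda>z. seiffert M z / z))
       \<and> (schur_concave M \<longleftrightarrow> mono_on {0<..<1} (\<lambda>z. seiffert M z / z))"
proof -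
  have sym: "symmetric_pos M" and hom: "homogeneous_pos M"
    using assms by (simp_all add: means_def homogeneous_pos_def)
  have sym': "symmetric_pos (\<lambda>x y. - M x y)" and hom': "homogeneous_pos (\<lambda>x y. - M x y)"
    using sym hom by (simp_all add: symmetric_pos_def homogeneous_pos_def)
  have pos: "trace M z > 0" if "z \<in> {0<..<1}" for z
    using mean_trace_bounds(1)[OF assms, of z] that by simp
  have quotient: "seiffert M z / z = inverse (trace M z)" if "z \<in> {0<..<1}" for z
    using that by (simp add: seiffert_def trace_def field_simps)
  have reverse: "seiffert M z / z \<le> seiffert M w / w \<longleftrightarrow> trace M w \<le> trace M z"
    if "w \<in> {0<..<1}" "z \<in> {0<..<1}" for w z
    using pos that by (simp only: quotient) (simp add: inverse_le_iff_le)
  have "schur_convex M \<longleftrightarrow> mono_on {0<..<1} (trace M)"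
    using schur_convex_iff_trace_mono[OF sym hom] mono_on_trace_include_zero(1)[OF assms] by simp
  moreover have "mono_on {0<..<1} (trace M) \<longleftrightarrow> antimono_on {0<..<1} (\<lambda>z. seiffert M z / z)"
    unfolding monotone_on_def using reverse by blast
  moreover have "schur_concave M \<longleftrightarrow> mono_on {0<..<1} (\<lambda>z. - trace M z)"
    using schur_convex_iff_trace_mono[OF sym' hom'] mono_on_trace_include_zero(2)[OF assms]
    by (simp add: schur_concave_iff_uminus trace_def[abs_def])
  moreover have "mono_on {0<..<1} (\<lambda>z. - trace M z) \<longleftrightarrow> mono_on {0<..<1} (\<lambda>z. seiffert M z / z)"
    unfolding monotone_on_def neg_le_iff_le using reverse by blast
  ultimately show ?thesis by blast
qed

end
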